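(* Let $k$ be a positive integer. Every $k$-uniform graph is a disjoint union of $1$-uniform and $2$-uniform graphs.
   Context: All graphs are finite, simple, loopless and undirected. For a vertex $v$ of a graph $G$, $N(v)$ is the set of neighbors of $v$ and $N[v]=N(v)\cup\{v\}$ is the closed neighborhood of $v$. A set $S\subseteq V(G)$ is a dominating set of $G$ if every vertex in $V(G)\setminus S$ is adjacent to some vertex in $S$. A sequence of distinct vertices $(v_1,\dots,v_m)$ of $G$ has length $m$. It is a closed neighborhood sequence (CNS) if $N[v_i]\nsubseteq \bigcup_{j=1}^{i-1}N[v_j]$ for each $i$ with $2\le i\le m$. It is a dominating CNS (dominating closed neighborhood sequence) if in addition $\{v_1,\dots,v_m\}$ is a dominating set of $G$. A graph $G$ is $k$-uniform if all dominating closed neighborhood sequences of $G$ have equal length $k$. The disjoint union has one or more summands, each of which is $1$-uniform or $2$-uniform (either kind may be absent). *)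

theory Defs
  imports "Graph_Theory.Pair_Digraph"
begin

(* A finite simple undirected graph is a pair_graph: a finite vertex set pverts G with a symmetric,
   irreflexive adjacency relation parcs G on it, so each undirected edge {u, v} is the two arcs
   (u, v) and (v, u). *)

definition nbhd :: "'a pair_pre_digraph \<Rightarrow> 'a \<Rightarrow> 'a set" where
  "nbhd G v = {u \<in> pverts G. (v, u) \<in> parcs G}"

definition closed_nbhd :: "'a pair_pre_digraph \<Rightarrow> 'a \<Rightarrow> 'a set" where
  "closed_nbhd G v = insert v (nbhd G v)"

definition dominating_set :: "'a pair_pre_digraph \<Rightarrow> 'a set \<Rightarrow> bool" where
  "dominating_set G S \<longleftrightarrow>
     S \<subseteq> pverts G \<and> (\<forall>v \<in> pverts G - S. \<exists>u \<in> S. (v, u) \<in> parcs G)"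

(* List positions start at 0, so the first vertex, which carries no condition, is i = 0.
   The empty sequence is allowed; it is dominating only for the graph without vertices, which is
   therefore 0-uniform and not k-uniform for any positive k. *)
definition cns :: "'a pair_pre_digraph \<Rightarrow> 'a list \<Rightarrow> bool" where
  "cns G vs \<longleftrightarrow>
     set vs \<subseteq> pverts G \<and> distinct vs \<and>
     (\<forall>i. 1 \<le> i \<and> i < length vs \<longrightarrow>
        \<not> closed_nbhd G (vs ! i) \<subseteq> (\<Union>j<i. closed_nbhd G (vs ! j)))"

definition dominating_cns :: "'a pair_pre_digraph \<Rightarrow> 'a list \<Rightarrow> bool" where
  "dominating_cns G vs \<longleftrightarrow> cns G vs \<and> dominating_set G (set vs)"

definition uniform :: "nat \<Rightarrow> 'a pair_pre_digraph \<Rightarrow> bool" where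
  "uniform k G \<longleftrightarrow> (\<forall>vs. dominating_cns G vs \<longrightarrow> length vs = k)"

(* Internal disjoint union of one or more graphs. Taking the summands as a set loses nothing when
   they have vertices: disjoint nonempty vertex sets make them distinct. *)
definition disjoint_union_of :: "'a pair_pre_digraph \<Rightarrow> 'a pair_pre_digraph set \<Rightarrow> bool" where
  "disjoint_union_of G \<H> \<longleftrightarrow>
     finite \<H> \<and> \<H> \<noteq> {} \<and> (\<forall>H \<in> \<H>. pair_graph H) \<and>
     pairwise (\<lambda>H K. disjnt (pverts H) (pverts K)) \<H> \<and>
     pverts G = (\<Union>H \<in> \<H>. pverts H) \<and>
     parcs G = (\<Union>H \<in> \<H>. parcs H)"

end

(* For a set S of vertices, let perp S be the set of vertices outside all closed neighbourhoods
   N[s] with s in S, and let cl S = perp (perp S); then v is in cl S iff N[v] is covered by the N[s].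
   Uniformity gives cl the exchange property, so its flats form a geometric lattice. The map perp is
   an order-reversing involution of this lattice without absolute points, so the lattice is modular:
   the closed twin classes of vertices form a finite projective geometry with a polarity under which
   no point lies on its polar.

   If some induced path a - b - c were not contained in a line, then in the plane spanned by it any
   two points would have exactly one common polar point, i.e. the relation "nonadjacent" would be a
   friendship graph. By the friendship theorem some point would be nonadjacent to all other points of
   the plane, which the path excludes. Hence every induced path with two edges is collinear, and
   each connected component lies in a single point or line: any two vertices of it with different
   closed neighbourhoods dominate the component. *)
theory Submission
  imports Defs "HOL-Number_Theory.Cong" "HOL-Computational_Algebra.Primes"
begin

section \<open>The friendship theorem\<close>

text \<open>The orbits of \<open>f\<close> partition \<open>X\<close>, and each has exactly
  \<open>p\<close> elements: a point with a shorter period \<open>d\<close> is fixed by the iterate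
  of order \<open>d * m\<close>, where \<open>m\<close> inverts \<open>d\<close> modulo
  \<open>p\<close>, and this iterate acts on it as \<open>f\<close> itself.\<close>

lemma prime_dvd_card_if_no_fixed_point:
  fixes f :: "'b \<Rightarrow> 'b" and p :: nat
  assumes p: "prime p" and fin: "finite X"
    and closed: "\<And>x. x \<in> X \<Longrightarrow> f x \<in> X"
    and period: "\<And>x. x \<in> X \<Longrightarrow> (f ^^ p) x = x"
    and no_fix: "\<And>x. x \<in> X \<Longrightarrow> f x \<noteq> x"
  shows "p dvd card X"
proof -
  have pow: "(f ^^ n) x \<in> X" if "x \<in> X" for n x
    using that by (induction n) (auto intro: closed)
  have mult: "(f ^^ (n * m)) x = x" if "(f ^^ n) x = x" for n m x
    using that by (induction m) (simp_all add: funpow_add)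
  have mod: "(f ^^ n) x = (f ^^ (n mod p)) x" if "x \<in> X" for n x
  proof -
    have "(f ^^ n) x = (f ^^ (n mod p + p * (n div p))) x" by simp
    also have "\<dots> = (f ^^ (n mod p)) ((f ^^ (p * (n div p))) x)"
      unfolding funpow_add by simp
    finally show ?thesis using mult[OF period[OF that]] by simp
  qed
  have coprime_fix: False if x: "x \<in> X" and d: "(f ^^ d) x = x" "0 < d" "d < p" for x d
  proof -
    have "coprime d p"
      using p d by (metis coprime_commute nat_dvd_not_less prime_imp_coprime)
    then obtain m where "[d * m = 1] (mod p)" using cong_solve_coprime_nat by auto
    then have "(d * m) mod p = 1" using prime_gt_1_nat[OF p] by (simp add: cong_def)
    then have "(f ^^ (d * m)) x = f x" using mod[OF x, of "d * m"] by simp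
    then show False using mult[OF d(1)] no_fix[OF x] by simp
  qed
  define r where "r = {(x, y). x \<in> X \<and> (\<exists>n. y = (f ^^ n) x)}"
  have "sym_on X r"
  proof (rule sym_onI)
    fix x y assume "(x, y) \<in> r"
    then obtain n where x: "x \<in> X" and y: "y = (f ^^ n) x" by (auto simp: r_def)
    \<comment> \<open>Running on to the end of the period returns to \<open>x\<close>, which gives
      symmetry of the orbit relation without an inverse of \<open>f\<close>.\<close>
    have "(f ^^ (p - n mod p)) y = (f ^^ (p - n mod p)) ((f ^^ (n mod p)) x)"
      using y mod[OF x] by simp
    also have "\<dots> = (f ^^ (p - n mod p + n mod p)) x" by (simp only: funpow_add comp_def)
    also have "\<dots> = x" using period[OF x] prime_gt_0_nat[OF p] by (simp add: less_imp_le)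
    finally have "(f ^^ (p - n mod p)) y = x" .
    then show "(y, x) \<in> r" using x y pow unfolding r_def by (metis (mono_tags, lifting) case_prodI mem_Collect_eq)
  qed
  moreover have "refl_on X r" unfolding r_def by (auto intro!: refl_onI exI[of _ 0])
  moreover have "trans r"
  proof (rule transI)
    fix x y z assume "(x, y) \<in> r" "(y, z) \<in> r"
    then obtain m n where "x \<in> X" "z = (f ^^ n) ((f ^^ m) x)" by (auto simp: r_def)
    then have "x \<in> X" "z = (f ^^ (n + m)) x" by (auto simp: funpow_add)
    then show "(x, z) \<in> r" by (auto simp: r_def)
  qed
  moreover have "r \<subseteq> X \<times> X" by (auto simp: r_def pow)
  ultimately have eq: "equiv X r" by (auto simp: equiv_def sym_on_def intro: symI)
  have "p dvd card B" if "B \<in> X // r" for B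
  proof -
    obtain x where x: "x \<in> X" and B: "B = r `` {x}" using \<open>B \<in> X // r\<close> by (rule quotientE)
    have "B = (\<lambda>n. (f ^^ n) x) ` {..<p}"
    proof
      show "B \<subseteq> (\<lambda>n. (f ^^ n) x) ` {..<p}"
      proof
        fix y assume "y \<in> B"
        then obtain n where "y = (f ^^ n) x" using B by (auto simp: r_def)
        then have "y = (f ^^ (n mod p)) x" using mod[OF x] by simp
        then show "y \<in> (\<lambda>n. (f ^^ n) x) ` {..<p}" using prime_gt_0_nat[OF p] by auto
      qed
    qed (use x B in \<open>auto simp: r_def\<close>)
    moreover have "(f ^^ i) x \<noteq> (f ^^ j) x" if "i < j" "j < p" for i j
    proof
      assume *: "(f ^^ i) x = (f ^^ j) x"
      have "(f ^^ (j - i)) ((f ^^ i) x) = (f ^^ (j - i + i)) x" by (simp only: funpow_add comp_def)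
      then have "(f ^^ (j - i)) ((f ^^ i) x) = (f ^^ i) x" using that * by simp
      then show False using coprime_fix[OF pow[OF x]] that by (metis diff_le_self le_less_trans zero_less_diff)
    qed
    then have "inj_on (\<lambda>n. (f ^^ n) x) {..<p}"
      by (intro linorder_inj_onI) auto
    ultimately show ?thesis by (simp add: card_image)
  qed
  then show ?thesis using equiv_imp_dvd_card[OF fin eq] by blast
qed

text \<open>Being fixed makes each entry equal to the next one. A closed walk fixed by rotation
  would therefore be constant and need a loop.\<close>

lemma rotate1_fixed_imp_set_singleton:
  assumes "rotate1 xs = xs" and "xs \<noteq> []"
  shows "set xs = {hd xs}"
proof -
  have "xs ! i = hd xs" if "i < length xs" for i
    using that
  proof (induction i)
    case 0
    then show ?case using assms by (simp add: hd_conv_nth)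
  next
    case (Suc i)
    have "rotate1 xs ! i = xs ! (Suc i mod length xs)" using Suc.prems by (intro nth_rotate1) simp
    then show ?case using assms Suc by simp
  qed
  then have "y = hd xs" if "y \<in> set xs" for y using that unfolding in_set_conv_nth by blast
  then show ?thesis using hd_in_set[OF assms(2)] by blast
qed

section \<open>Degrees in friendship graphs\<close>

locale friendship_graph =
  fixes F :: "'a set" and P :: "'a \<Rightarrow> 'a \<Rightarrow> bool"
  assumes fin: "finite F" and nonempty: "F \<noteq> {}"
    and sym: "\<And>a b. \<lbrakk>a \<in> F; b \<in> F; P a b\<rbrakk> \<Longrightarrow> P b a"
    and irrefl: "\<And>a. a \<in> F \<Longrightarrow> \<not> P a a"
    and friend: "\<And>a b. \<lbrakk>a \<in> F; b \<in> F; a \<noteq> b\<rbrakk> \<Longrightarrow> \<exists>!c. c \<in> F \<and> P a c \<and> P b c"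
begin

definition nb :: "'a \<Rightarrow> 'a set" where
  "nb a = {b \<in> F. P a b}"

text \<open>A walk is recorded by its inner vertices only, so \<open>l\<close> is one less than its
  number of edges.\<close>

definition walks :: "nat \<Rightarrow> 'a \<Rightarrow> 'a \<Rightarrow> 'a list set" where
  "walks l a b = {xs. length xs = l \<and> set xs \<subseteq> F \<and> successively P (a # xs @ [b])}"

lemma finite_nb [simp]: "finite (nb a)"
  using fin by (simp add: nb_def)

lemma finite_walks [simp]: "finite (walks l a b)"
  by (rule finite_subset[OF _ finite_lists_length_eq[OF fin, of l]]) (auto simp: walks_def)

lemma common_friend_unique:
  assumes "a \<in> F" "b \<in> F" "a \<noteq> b" "c \<in> F" "P a c" "P b c" "d \<in> F" "P a d" "P b d"
  shows "c = d"
  using friend[OF assms(1-3)] assms by (elim ex1E) metis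

text \<open>Send a neighbor \<open>c\<close> of \<open>a\<close> to the common friend of
  \<open>b\<close> and \<open>c\<close>. This is injective: neighbors \<open>c\<close>,
  \<open>d\<close> with the same image are both common friends of \<open>a\<close> and that image,
  which differs from \<open>a\<close> because \<open>a\<close> and \<open>b\<close> are not
  friends.\<close>

lemma card_nb_le:
  assumes ab: "a \<in> F" "b \<in> F" "\<not> P a b"
  shows "card (nb a) \<le> card (nb b)"
proof (cases "a = b")
  case False
  define h where "h c = (THE d. d \<in> F \<and> P b d \<and> P c d)" for c
  have h: "h c \<in> F \<and> P b (h c) \<and> P c (h c)" if "c \<in> nb a" for c
  proof -
    have "b \<noteq> c" "c \<in> F" using that ab by (auto simp: nb_def)
    then show ?thesis using theI'[OF friend[of b c]] ab unfolding h_def by blast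
  qed
  have "inj_on h (nb a)"
  proof (rule inj_onI)
    fix c d assume cd: "c \<in> nb a" "d \<in> nb a" "h c = h d"
    have "h c \<noteq> a" using h[OF cd(1)] ab sym by blast
    then show "c = d"
      using common_friend_unique[of a "h c" c d] h[OF cd(1)] h[OF cd(2)] cd ab sym
      unfolding nb_def by (metis (no_types, lifting) mem_Collect_eq)
  qed
  moreover have "h ` nb a \<subseteq> nb b" using h by (auto simp: nb_def)
  ultimately show ?thesis by (metis card_inj_on_le finite_nb)
qed simp

lemma card_nb_eq:
  assumes "a \<in> F" "b \<in> F" "\<not> P a b"
  shows "card (nb a) = card (nb b)"
proof -
  have "\<not> P b a" using assms sym by blast
  then show ?thesis using card_nb_le assms by (simp add: le_antisym)
qed

text \<open>Vertices of different degrees are friends. If \<open>a\<close> and \<open>b\<close> have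
  different degrees, their common friend \<open>c\<close> differs in degree from one of them, say
  from \<open>a\<close>. A non-friend \<open>d\<close> of \<open>a\<close> has the degree of
  \<open>a\<close>, hence is a friend of \<open>b\<close> and \<open>c\<close>; then
  \<open>a\<close> and \<open>d\<close> are two common friends of \<open>b\<close> and
  \<open>c\<close>. So \<open>a\<close> would be universal.\<close>

lemma regular_if_no_universal:
  assumes no_univ: "\<And>u. u \<in> F \<Longrightarrow> \<exists>v\<in>F. v \<noteq> u \<and> \<not> P u v"
    and ab: "a \<in> F" "b \<in> F"
  shows "card (nb a) = card (nb b)"
proof (rule ccontr)
  assume neq: "card (nb a) \<noteq> card (nb b)"
  have claim: False
    if a: "a \<in> F" and b: "b \<in> F" and c: "c \<in> F" "P a c" "P b c"
      and neq: "card (nb a) \<noteq> card (nb b)" and neq': "card (nb c) \<noteq> card (nb a)" for a b c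
  proof -
    have "P a d" if d: "d \<in> F" "d \<noteq> a" for d
    proof (rule ccontr)
      assume "\<not> P a d"
      then have da: "card (nb d) = card (nb a)" using card_nb_eq a d by metis
      then have "P d b" "P d c" using card_nb_eq b c d neq neq' by metis+
      moreover have "P a b" using card_nb_eq a b neq by blast
      moreover have "b \<noteq> c" using c b irrefl by blast
      ultimately show False using common_friend_unique[of b c a d] a b c d sym by blast
    qed
    then show False using no_univ[OF a] by blast
  qed
  have "a \<noteq> b" using neq by auto
  then obtain c where "c \<in> F" "P a c" "P b c" using friend[OF ab] by blast
  then show False
    using claim[of a b c] claim[of b a c] neq ab by metis
qed

section \<open>Counting walks modulo a prime\<close>

lemma card_walks_Suc: "card (walks (Suc l) a b) = (\<Sum>c\<in>nb a. card (walks l c b))"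
proof -
  have "walks (Suc l) a b = (\<Union>c\<in>nb a. (#) c ` walks l c b)"
    by (auto simp: walks_def nb_def length_Suc_conv image_iff)
  also have "card \<dots> = (\<Sum>c\<in>nb a. card ((#) c ` walks l c b))"
    by (rule card_UN_disjoint) auto
  finally show ?thesis by (simp add: card_image)
qed

lemma card_walks_0: "b \<in> F \<Longrightarrow> card (walks 0 c b) = (if b \<in> nb c then 1 else 0)"
proof -
  assume "b \<in> F"
  then have "walks 0 c b = (if b \<in> nb c then {[]} else {})" by (auto simp: walks_def nb_def)
  then show ?thesis by simp
qed

text \<open>The friendship condition in matrix form: the square of the adjacency matrix has the
  degrees on the diagonal and ones elsewhere.\<close>

lemma card_walks_1:
  assumes "a \<in> F" "b \<in> F"
  shows "card (walks (Suc 0) a b) = (if a = b then card (nb a) else 1)"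
proof -
  have eq: "card (walks (Suc 0) a b) = card {c \<in> nb a. b \<in> nb c}"
    using assms by (simp add: card_walks_Suc card_walks_0 sum.If_cases Int_def)
  show ?thesis
  proof (cases "a = b")
    case True
    then have "{c \<in> nb a. b \<in> nb c} = nb a" using assms sym unfolding nb_def by blast
    then show ?thesis using eq True by simp
  next
    case False
    then obtain c where "c \<in> F" "P a c" "P b c" using friend assms by blast
    then have "{c \<in> nb a. b \<in> nb c} = {c}"
      using common_friend_unique[of a b] assms sym False unfolding nb_def by blast
    then show ?thesis using eq False by simp
  qed
qed

text \<open>Let p be a prime divisor of k - 1, where k is the common degree. Modulo p, the
  number of walks of any given length at least 2 between two vertices is 1, so the number of closed
  walks of length p is card F = k (k - 1) + 1, hence 1. Rotation acts on these walks without fixed points.\<close>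

theorem ex_universal: "\<exists>u\<in>F. \<forall>v\<in>F. v \<noteq> u \<longrightarrow> P u v"
proof (rule ccontr)
  assume "\<not> ?thesis"
  then have no_univ: "\<exists>v\<in>F. v \<noteq> u \<and> \<not> P u v" if "u \<in> F" for u using that by blast
  obtain a where a: "a \<in> F" using nonempty by blast
  define k where "k = card (nb a)"
  have deg: "card (nb b) = k" if "b \<in> F" for b
    unfolding k_def using regular_if_no_universal[OF no_univ that a] .
  \<comment> \<open>The walks with two edges from \<open>a\<close> are counted twice, by their end
    and by their middle vertex, to obtain \<open>card F\<close>.\<close>
  have "(\<Sum>b\<in>F. card (walks (Suc 0) a b)) = k + (card F - 1)"
  proof -
    have "(\<Sum>b\<in>F - {a}. card (walks (Suc 0) a b)) = (\<Sum>b\<in>F - {a}. 1)"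
      using card_walks_1[OF a] by (intro sum.cong) auto
    then show ?thesis
      using card_walks_1[OF a a] fin a by (simp add: sum.remove[OF fin a] k_def)
  qed
  moreover have "(\<Sum>b\<in>F. card (walks (Suc 0) a b)) = k * k"
  proof -
    have "(\<Sum>b\<in>F. card (walks (Suc 0) a b)) = (\<Sum>c\<in>nb a. \<Sum>b\<in>F. card (walks 0 c b))"
      unfolding card_walks_Suc by (rule sum.swap)
    also have "\<dots> = (\<Sum>c\<in>nb a. card (nb c))"
    proof (rule sum.cong)
      fix c
      have "F \<inter> nb c = nb c" by (auto simp: nb_def)
      then show "(\<Sum>b\<in>F. card (walks 0 c b)) = card (nb c)"
        using fin by (simp add: card_walks_0 sum.If_cases)
    qed simp
    also have "\<dots> = k * k" using deg by (simp add: nb_def k_def)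
    finally show ?thesis .
  qed
  ultimately have size: "k * k = k + (card F - 1)" by simp
  have Fpos: "card F \<ge> 1" using a fin by (metis One_nat_def Suc_leI card_gt_0_iff empty_iff)
  \<comment> \<open>A non-friend of \<open>a\<close> gives \<open>card F \<ge> k + 2\<close>. This
    excludes \<open>k = 2\<close>, where \<open>k - 1\<close> has no prime divisor, and
    \<open>k = 0\<close>, where the subtraction is truncated. For \<open>k = 1\<close> every prime
    divides \<open>k - 1\<close>.\<close>
  obtain v where v: "v \<in> F" "v \<noteq> a" "\<not> P a v" using no_univ[OF a] by blast
  then obtain c where c: "c \<in> F" "P a c" "P v c" using friend[of a v] a by blast
  have sub: "insert a (insert v (nb a)) \<subseteq> F" using a v by (auto simp: nb_def)
  have "card (insert a (insert v (nb a))) = k + 2"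
    using v irrefl[OF a] by (simp add: nb_def k_def fin)
  then have Fk: "card F \<ge> k + 2" using card_mono[OF fin sub] by simp
  have "k \<noteq> 2"
  proof
    assume "k = 2"
    then show False using size Fk by simp
  qed
  moreover have "k \<noteq> 0"
  proof
    assume "k = 0"
    then show False using size Fk by simp
  qed
  ultimately have "k - 1 \<noteq> 1" and k: "k \<ge> 1" by linarith+
  then obtain p where p: "prime p" "p dvd k - 1" using prime_factor_nat[of "k - 1"] by blast
  have k1: "[k = 1] (mod p)" using p k by (metis cong_altdef_nat)
  have n1: "[card F = 1] (mod p)"
  proof -
    have "card F - 1 = k * (k - 1)" using size by (simp add: algebra_simps)
    then have "p dvd card F - 1" using p by simp
    then show ?thesis using Fpos by (metis cong_altdef_nat)
  qed
  have sum_one: "[(\<Sum>c\<in>A. g c) = card A] (mod p)" if "\<And>c. c \<in> A \<Longrightarrow> [g c = 1] (mod p)" for A g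
    using cong_sum[of A g "\<lambda>_. 1" p] that by simp
  have walks1: "[card (walks (Suc l) b c) = 1] (mod p)" if "b \<in> F" "c \<in> F" for l b c
    using that
  proof (induction l arbitrary: b)
    case 0
    then show ?case using card_walks_1[of b c] deg k1 by auto
  next
    case (Suc l)
    have "[card (walks (Suc (Suc l)) b c) = card (nb b)] (mod p)"
      unfolding card_walks_Suc[of "Suc l"] by (rule sum_one) (use Suc in \<open>auto simp: nb_def\<close>)
    then show ?case using deg[OF Suc.prems(1)] k1 cong_trans by metis
  qed
  obtain l where l: "p = Suc (Suc l)"
    using prime_ge_2_nat[OF p(1)] by (metis Suc_le_D numeral_2_eq_2 Suc_le_mono)
  \<comment> \<open>Closed walks with \<open>p\<close> edges, listed with their starting vertex so
    that \<open>rotate1\<close> acts on them: one start and \<open>Suc l = p - 1\<close> inner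
    vertices.\<close>
  define Z where "Z = (\<Union>b\<in>F. (#) b ` walks (Suc l) b b)"
  have "card Z = (\<Sum>b\<in>F. card ((#) b ` walks (Suc l) b b))"
    unfolding Z_def using fin by (intro card_UN_disjoint) auto
  also have "\<dots> = (\<Sum>b\<in>F. card (walks (Suc l) b b))" by (simp add: card_image)
  finally have "[card Z = card F] (mod p)" using sum_one[of F] walks1 by simp
  then have Z1: "[card Z = 1] (mod p)" using n1 cong_trans by blast
  have Z: "Z = {xs. length xs = p \<and> set xs \<subseteq> F \<and> successively P (xs @ [hd xs])}"
    by (auto simp: Z_def walks_def l length_Suc_conv image_iff)
  have "p dvd card Z"
  proof (rule prime_dvd_card_if_no_fixed_point[OF p(1), of Z rotate1])
    show "finite Z" using fin by (simp add: Z_def)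
    show "(rotate1 ^^ p) xs = xs" if "xs \<in> Z" for xs
      using that by (simp add: Z rotate_def[symmetric])
    show "rotate1 xs \<noteq> xs" if xs: "xs \<in> Z" for xs
    proof
      assume "rotate1 xs = xs"
      obtain b c ys where 1: "xs = b # c # ys" using xs by (auto simp: Z l length_Suc_conv)
      then have "b = c" using rotate1_fixed_imp_set_singleton[OF \<open>rotate1 xs = xs\<close>] by auto
      then show False using 1 xs irrefl by (auto simp: Z)
    qed
    show "rotate1 xs \<in> Z" if xs: "xs \<in> Z" for xs
    proof -
      obtain b c ys where 1: "xs = b # c # ys" using xs by (auto simp: Z l length_Suc_conv)
      then have "successively P (c # ys @ [b])" "P b c" using xs by (auto simp: Z successively_Cons)
      then have "successively P ((c # ys @ [b]) @ [c])" by (subst successively_append_iff) simp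
      then show ?thesis using xs 1 by (auto simp: Z)
    qed
  qed
  then have "[card Z = 0] (mod p)" by (simp add: cong_0_iff)
  then have "[0 = 1] (mod p)" using Z1 cong_sym cong_trans by blast
  then show False using prime_gt_1_nat[OF p(1)] by (simp add: cong_def)
qed

end

section \<open>Projective geometry of an orthogonality relation\<close>

locale orthogeometry =
  fixes V :: "'a set" and orth :: "'a \<Rightarrow> 'a \<Rightarrow> bool"
  assumes fin: "finite V"
    and sym: "\<And>x y. \<lbrakk>x \<in> V; y \<in> V; orth x y\<rbrakk> \<Longrightarrow> orth y x"
    and irrefl: "\<And>x. x \<in> V \<Longrightarrow> \<not> orth x x"
begin

definition perp :: "'a set \<Rightarrow> 'a set" where
  "perp S = {w \<in> V. \<forall>s\<in>S. orth w s}"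

definition cl :: "'a set \<Rightarrow> 'a set" where
  "cl S = perp (perp S)"

lemma orth_commute: "\<lbrakk>x \<in> V; y \<in> V\<rbrakk> \<Longrightarrow> orth x y \<longleftrightarrow> orth y x"
  using sym by blast

lemma perp_subset: "perp S \<subseteq> V"
  by (auto simp: perp_def)

lemma cl_subset: "cl S \<subseteq> V"
  by (simp add: cl_def perp_subset)

lemma subset_cl: "S \<subseteq> V \<Longrightarrow> S \<subseteq> cl S"
  using sym unfolding cl_def perp_def by blast

lemma perp_antimono: "S \<subseteq> T \<Longrightarrow> perp T \<subseteq> perp S"
  by (auto simp: perp_def)

lemma cl_mono: "S \<subseteq> T \<Longrightarrow> cl S \<subseteq> cl T"
  by (simp add: cl_def perp_antimono)

lemma perp_cl: "S \<subseteq> V \<Longrightarrow> perp (cl S) = perp S"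
  using subset_cl[OF perp_subset[of S]] perp_antimono[OF subset_cl] by (auto simp: cl_def)

lemma cl_least: "\<lbrakk>T \<subseteq> V; S \<subseteq> cl T\<rbrakk> \<Longrightarrow> cl S \<subseteq> cl T"
  using perp_antimono[of S "cl T"] perp_antimono[of "perp T" "perp S"] perp_cl[of T]
  by (simp add: cl_def)

lemma orth_cl:
  assumes "T \<subseteq> V" "w \<in> V" "\<And>t. t \<in> T \<Longrightarrow> orth w t" "v \<in> cl T"
  shows "orth w v"
  using assms sym unfolding cl_def perp_def by blast

lemma orth_not_in_cl:
  assumes "T \<subseteq> V" "w \<in> V" "\<And>t. t \<in> T \<Longrightarrow> orth w t"
  shows "w \<notin> cl T"
  using orth_cl[OF assms(1-3)] irrefl[OF assms(2)] by blast

text \<open>\<open>perp {}\<close> is \<open>V\<close>, and no point is orthogonal to all of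
  \<open>V\<close>, since it is not orthogonal to itself.\<close>

lemma cl_empty: "cl {} = {}"
  using irrefl by (auto simp: cl_def perp_def)

end

section \<open>Points, lines and polars under exchange\<close>

text \<open>Exchange makes \<open>cl\<close> the closure operator of a matroid. Its points are the
  classes \<open>cl {x}\<close> of parallel elements; two nonparallel elements span a line, three
  independent ones a plane.\<close>

locale exchange_orthogeometry = orthogeometry +
  assumes exchange: "\<And>S u v. \<lbrakk>S \<subseteq> V; u \<in> V; v \<in> cl (insert u S); v \<notin> cl S\<rbrakk> \<Longrightarrow> u \<in> cl (insert v S)"
begin

lemma in_cl_sing_sym:
  assumes "x \<in> V" "v \<in> cl {x}" shows "x \<in> cl {v}"
  using exchange[of "{}" x v] assms by (simp add: cl_empty)

lemma cl_sing_eq: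
  assumes "x \<in> V" "v \<in> cl {x}" shows "cl {v} = cl {x}"
proof
  have "v \<in> V" using assms(2) cl_subset by blast
  then show "cl {v} \<subseteq> cl {x}" "cl {x} \<subseteq> cl {v}"
    using assms in_cl_sing_sym[OF assms] by (simp_all add: cl_least)
qed

lemma cl_insert_eq:
  assumes "S \<subseteq> V" "u \<in> V" "v \<in> cl (insert u S)" "v \<notin> cl S"
  shows "cl (insert v S) = cl (insert u S)"
proof
  have v: "v \<in> V" using assms(3) cl_subset by blast
  have "S \<subseteq> cl (insert u S)" "S \<subseteq> cl (insert v S)"
    using assms v subset_cl[of "insert u S"] subset_cl[of "insert v S"] by auto
  then show "cl (insert v S) \<subseteq> cl (insert u S)" "cl (insert u S) \<subseteq> cl (insert v S)"
    using assms v exchange[OF assms] by (simp_all add: cl_least)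
qed

text \<open>Two exchanges: first \<open>v\<close> replaces \<open>x\<close> or \<open>y\<close>,
  leaving a generator \<open>t\<close>, then \<open>w\<close> replaces \<open>t\<close>. If
  \<open>v\<close> is parallel to \<open>x\<close>, the generator kept is \<open>y\<close>,
  otherwise \<open>x\<close>.\<close>

lemma line_eq:
  assumes xy: "x \<in> V" "y \<in> V" and v: "v \<in> cl {x, y}" and w: "w \<in> cl {x, y}" "w \<notin> cl {v}"
  shows "cl {v, w} = cl {x, y}"
proof -
  have vV: "v \<in> V" using v cl_subset by blast
  have "\<exists>t\<in>V. cl {v, t} = cl {x, y}"
  proof (cases "v \<in> cl {x}")
    case False
    then have "cl {v, x} = cl {x, y}"
      using cl_insert_eq[of "{x}" y v] xy v by (simp add: insert_commute)
    then show ?thesis using xy by blast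
  next
    case True
    then have "x \<in> cl {v}" "v \<in> cl {x}" using in_cl_sing_sym xy by auto
    then have "x \<in> cl {v, y}" "v \<in> cl {x, y}" "y \<in> cl {v, y}" "y \<in> cl {x, y}"
      using cl_mono[of "{v}" "{v, y}"] cl_mono[of "{x}" "{x, y}"] subset_cl[of "{v, y}"]
        subset_cl[of "{x, y}"] vV xy by auto
    then have "cl {v, y} = cl {x, y}"
      using vV xy by (intro equalityI cl_least) auto
    then show ?thesis using xy by blast
  qed
  then obtain t where t: "t \<in> V" "cl {v, t} = cl {x, y}" by blast
  then show ?thesis
    using cl_insert_eq[of "{v}" t w] vV w by (simp add: insert_commute)
qed

text \<open>Modularity of the lattice of flats enters the argument only through this lemma.\<close>

lemma line_meets_perp:
  assumes xy: "x \<in> V" "y \<in> V" "y \<notin> cl {x}" and w: "w \<in> V"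
  obtains v where "v \<in> cl {x, y}" "orth v w"
proof -
  have "\<exists>v\<in>cl {x, y}. orth v w"
  proof (rule ccontr)
    assume *: "\<not> ?thesis"
    \<comment> \<open>If no point of the line is orthogonal to \<open>w\<close>, then
      \<open>M\<close> and \<open>w\<close> together span \<open>V\<close>. The point
      \<open>v\<close> below, orthogonal to \<open>x\<close> but not to \<open>y\<close>, lies
      outside \<open>cl M\<close>, so exchange puts \<open>w\<close> into the span of
      \<open>M\<close> and \<open>v\<close>. All of that span is orthogonal to \<open>x\<close>, a
      contradiction.\<close>
    define M where "M = perp {x, y}"
    have M: "M \<subseteq> V" "perp M = cl {x, y}" by (simp_all add: M_def perp_subset cl_def)
    obtain v where v: "v \<in> V" "orth v x" "\<not> orth v y"
      using xy sym unfolding cl_def perp_def by blast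
    have "perp (insert w M) = {}" using * M(2) by (auto simp: perp_def)
    then have "v \<in> cl (insert w M)" using v by (simp add: cl_def[of "insert w M"] perp_def[of "{}"])
    moreover have "v \<notin> cl M"
      using v xy perp_cl[of "{x, y}"] by (simp add: cl_def[of M] M(2)) (simp add: perp_def)
    ultimately have "w \<in> cl (insert v M)" using exchange M(1) w by blast
    moreover have "x \<in> perp (insert v M)"
      using v xy orth_commute subset_cl[of "{x, y}"] M(2) by (auto simp: perp_def)
    ultimately have "orth x w" using orth_commute w xy by (auto simp: cl_def perp_def)
    then show False using * xy subset_cl[of "{x, y}"] by auto
  qed
  then show ?thesis using that by blast
qed

lemma orth_companion:
  assumes xy: "x \<in> V" "y \<in> V" "y \<notin> cl {x}"
  obtains x' where "x' \<in> cl {x, y}" "orth x' x"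
  using line_meets_perp[OF xy xy(1)] .

section \<open>Rank and polarity in a plane\<close>

text \<open>Elements of \<open>S\<close> are dropped until \<open>v\<close> leaves the closure; the
  element whose removal expels \<open>v\<close> can be exchanged for \<open>v\<close>.\<close>

lemma steinitz_step:
  assumes "finite S" "S \<subseteq> V" "A \<subseteq> V" "v \<in> cl (A \<union> S)" "v \<notin> cl A"
  shows "\<exists>s\<in>S. cl (A \<union> S) \<subseteq> cl (insert v A \<union> (S - {s}))"
proof -
  have v: "v \<in> V" using assms(4) cl_subset by blast
  have "\<exists>s\<in>S. s \<in> cl (insert v A \<union> (S - {s}))"
    using assms(1,2,4)
  proof (induction S)
    case empty
    then show ?case using assms by simp
  next
    case (insert s S)
    show ?case
    proof (cases "v \<in> cl (A \<union> S)")
      case True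
      then obtain t where t: "t \<in> S" "t \<in> cl (insert v A \<union> (S - {t}))"
        using insert by auto
      then have "t \<in> cl (insert v A \<union> (insert s S - {t}))"
        using cl_mono[of "insert v A \<union> (S - {t})" "insert v A \<union> (insert s S - {t})"] by blast
      then show ?thesis using t by blast
    next
      case False
      then have "s \<in> cl (insert v (A \<union> S))" using exchange[of "A \<union> S" s v] insert assms by auto
      then show ?thesis using insert.hyps by auto
    qed
  qed
  then obtain s where s: "s \<in> S" "s \<in> cl (insert v A \<union> (S - {s}))" by blast
  have "insert v A \<union> (S - {s}) \<subseteq> V" using assms v by auto
  then have "A \<union> S \<subseteq> cl (insert v A \<union> (S - {s}))"
    using s subset_cl[of "insert v A \<union> (S - {s})"] by auto
  then show ?thesis using s \<open>insert v A \<union> (S - {s}) \<subseteq> V\<close> by (meson cl_least)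
qed

text \<open>Mutually orthogonal points are independent, because a point orthogonal to a set is not
  in its closure. A plane has rank at most 3: three Steinitz steps show that \<open>a\<close>,
  \<open>b\<close>, \<open>c\<close> already span it, and \<open>d\<close> is orthogonal to all of
  them.\<close>

lemma orthogonal_quadruple_not_in_plane:
  assumes xyz: "x \<in> V" "y \<in> V" "z \<in> V"
    and F: "a \<in> cl {x, y, z}" "b \<in> cl {x, y, z}" "c \<in> cl {x, y, z}" "d \<in> cl {x, y, z}"
    and orth: "orth b a" "orth c a" "orth c b" "orth d a" "orth d b" "orth d c"
  shows False
proof -
  have V: "a \<in> V" "b \<in> V" "c \<in> V" "d \<in> V" using F cl_subset by auto
  have step: "\<exists>S'. finite S' \<and> S' \<subseteq> V \<and> card S' \<le> n \<and> cl {x, y, z} \<subseteq> cl (insert v A \<union> S')"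
    if S: "finite S" "S \<subseteq> V" "card S \<le> Suc n" "cl {x, y, z} \<subseteq> cl (A \<union> S)" "A \<subseteq> V"
      "v \<in> cl {x, y, z}" "v \<notin> cl A" for S A v n
  proof -
    have "v \<in> cl (A \<union> S)" using S by blast
    then obtain s where s: "s \<in> S" "cl (A \<union> S) \<subseteq> cl (insert v A \<union> (S - {s}))"
      using steinitz_step[of S A v] S by blast
    then have "card (S - {s}) \<le> n" using S by simp
    then show ?thesis using s S by (intro exI[of _ "S - {s}"]) auto
  qed
  have "card {x, y, z} \<le> Suc 2" by (simp add: card_insert_if)
  then obtain S1 where "finite S1" "S1 \<subseteq> V" "card S1 \<le> 2" "cl {x, y, z} \<subseteq> cl ({a} \<union> S1)"
    using step[of "{x, y, z}" 2 "{}" a] xyz F by (auto simp: cl_empty)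
  moreover have "b \<notin> cl {a}" using orth V by (intro orth_not_in_cl) auto
  ultimately obtain S2 where "finite S2" "S2 \<subseteq> V" "card S2 \<le> 1" "cl {x, y, z} \<subseteq> cl ({b, a} \<union> S2)"
    using step[of S1 1 "{a}" b] V F by auto
  moreover have "c \<notin> cl {b, a}" using orth V by (intro orth_not_in_cl) auto
  ultimately obtain S3 where "finite S3" "card S3 \<le> 0" "cl {x, y, z} \<subseteq> cl ({c, b, a} \<union> S3)"
    using step[of S2 0 "{b, a}" c] V F by auto
  then have "d \<in> cl {c, b, a}" using F by auto
  moreover have "d \<notin> cl {c, b, a}" using orth V by (intro orth_not_in_cl) auto
  ultimately show False by blast
qed

text \<open>Each side of the triangle \<open>x\<close>, \<open>y\<close>, \<open>z\<close> contains
  a point orthogonal to \<open>a\<close>. These three are not all parallel, since a point common to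
  all sides would be parallel to both \<open>x\<close> and \<open>y\<close>. So two of them span a
  line orthogonal to \<open>a\<close>, and this line contains a point orthogonal to
  \<open>b\<close>.\<close>

lemma plane_common_orth:
  assumes xyz: "x \<in> V" "y \<in> V" "z \<in> V" "y \<notin> cl {x}" "z \<notin> cl {x, y}"
    and ab: "a \<in> V" "b \<in> V"
  obtains c where "c \<in> cl {x, y, z}" "orth c a" "orth c b"
proof -
  have sub: "cl {x, y} \<subseteq> cl {x, y, z}" "cl {x, z} \<subseteq> cl {x, y, z}" "cl {y, z} \<subseteq> cl {x, y, z}"
    by (auto intro!: cl_mono)
  have "z \<notin> cl {x}" "z \<notin> cl {y}"
    using cl_mono[of "{x}" "{x, y}"] cl_mono[of "{y}" "{x, y}"] xyz by auto
  then obtain s t u where s: "s \<in> cl {x, y}" "orth s a" and t: "t \<in> cl {x, z}" "orth t a"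
    and u: "u \<in> cl {y, z}" "orth u a"
    using line_meets_perp[of _ _ a] xyz ab by metis
  have V: "s \<in> V" "t \<in> V" "u \<in> V" using s t u cl_subset by auto
  have sx: "s \<in> cl {x}" if "t \<in> cl {s}"
  proof (rule ccontr)
    assume no: "s \<notin> cl {x}"
    have "s \<in> cl {t}" using in_cl_sing_sym that V by blast
    then have "s \<in> cl {x, z}" using cl_least[of "{x, z}" "{t}"] t xyz by auto
    then have "cl {x, s} = cl {x, z}" "cl {x, s} = cl {x, y}"
      using line_eq[of x _ x s] subset_cl[of "{x, z}"] subset_cl[of "{x, y}"] no s xyz by auto
    then show False using xyz subset_cl[of "{x, z}"] by auto
  qed
  have sy: "s \<in> cl {y}" if "u \<in> cl {s}"
  proof (rule ccontr)
    assume no: "s \<notin> cl {y}"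
    have "s \<in> cl {u}" using in_cl_sing_sym that V by blast
    then have "s \<in> cl {y, z}" using cl_least[of "{y, z}" "{u}"] u xyz by auto
    then have "cl {y, s} = cl {y, z}" "cl {y, s} = cl {x, y}"
      using line_eq[of y _ y s] line_eq[of x y y s] subset_cl[of "{y, z}"] subset_cl[of "{x, y}"] no s xyz by auto
    then show False using xyz subset_cl[of "{y, z}"] by auto
  qed
  have "t \<notin> cl {s} \<or> u \<notin> cl {s}"
  proof (rule ccontr)
    assume "\<not> ?thesis"
    then have "s \<in> cl {x}" "s \<in> cl {y}" using sx sy by auto
    then have "cl {x} = cl {y}" using cl_sing_eq xyz by metis
    then show False using xyz subset_cl[of "{y}"] by auto
  qed
  then obtain r where r: "r \<in> cl {x, y, z}" "orth r a" "r \<notin> cl {s}" using t u sub by blast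
  have rV: "r \<in> V" using r cl_subset by blast
  obtain c where c: "c \<in> cl {s, r}" "orth c b" using line_meets_perp V rV r ab by metis
  have "c \<in> cl {x, y, z}" using cl_least[of "{x, y, z}" "{s, r}"] c r s sub xyz by auto
  moreover have "orth c a"
  proof -
    have "orth a c" using orth_cl[of "{s, r}" a c] ab V rV s r c orth_commute by auto
    then show ?thesis using sym ab c cl_subset by blast
  qed
  ultimately show ?thesis using that c by blast
qed

text \<open>If \<open>c\<close> and \<open>d\<close> were not parallel, the lines through
  \<open>a\<close>, \<open>b\<close> and through \<open>c\<close>, \<open>d\<close> would be
  orthogonal to each other. An orthogonal pair chosen on each would form an orthogonal quadruple in
  the plane.\<close>

lemma plane_common_orth_unique:
  assumes xyz: "x \<in> V" "y \<in> V" "z \<in> V"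
    and ab: "a \<in> cl {x, y, z}" "b \<in> cl {x, y, z}" "b \<notin> cl {a}"
    and cd: "c \<in> cl {x, y, z}" "d \<in> cl {x, y, z}"
    and orth: "orth c a" "orth c b" "orth d a" "orth d b"
  shows "d \<in> cl {c}"
proof (rule ccontr)
  assume "d \<notin> cl {c}"
  have V: "a \<in> V" "b \<in> V" "c \<in> V" "d \<in> V" using ab cd cl_subset by auto
  obtain b' where b': "b' \<in> cl {a, b}" "orth b' a" using orth_companion V ab by metis
  obtain d' where d': "d' \<in> cl {c, d}" "orth d' c" using orth_companion V \<open>d \<notin> cl {c}\<close> by metis
  have V': "b' \<in> V" "d' \<in> V" using b' d' cl_subset by auto
  have cb: "orth c v" "orth d v" if "v \<in> cl {a, b}" for v
    using orth_cl[of "{a, b}" _ v] that orth V by auto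
  have *: "orth v d'" if "v \<in> cl {a, b}" for v
    using orth_cl[of "{c, d}" v d'] cb[OF that] that d' V sym cl_subset by blast
  have "a \<in> cl {a, b}" using V subset_cl[of "{a, b}"] by auto
  then have "orth d' a" "orth d' b'" "orth c b'" using * b' cb V V' sym by blast+
  moreover have "cl {a, b} \<subseteq> cl {x, y, z}" "cl {c, d} \<subseteq> cl {x, y, z}"
    using ab cd xyz by (simp_all add: cl_least)
  ultimately show False
    using orthogonal_quadruple_not_in_plane[of x y z a b' c d'] xyz ab cd b' d' orth by auto
qed

section \<open>Induced paths and lines\<close>

text \<open>Otherwise the classes of parallel points of the plane spanned by the path, related by
  orthogonality, form a friendship graph; its universal point would be orthogonal to the whole path
  or parallel to a point of it, and neither is possible.\<close>

lemma induced_path_collinear: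
  assumes abc: "a \<in> V" "b \<in> V" "c \<in> V" and path: "\<not> orth a b" "\<not> orth b c" "orth a c"
  shows "b \<in> cl {a, c}"
proof (rule ccontr)
  assume b: "b \<notin> cl {a, c}"
  have c: "c \<notin> cl {a}" using orth_not_in_cl[of "{a}" c] abc path orth_commute by auto
  define F where "F = cl {a, c, b}"
  \<comment> \<open>The choice depends only on the set \<open>cl {v}\<close>, so parallel points
    receive the same representative.\<close>
  define \<rho> where "\<rho> v = (SOME w. w \<in> cl {v})" for v
  define R where "R = \<rho> ` F"
  have FV: "F \<subseteq> V" using cl_subset by (simp add: F_def)
  have abcF: "a \<in> F" "b \<in> F" "c \<in> F" using subset_cl[of "{a, c, b}"] abc by (auto simp: F_def)
  have \<rho>_cl: "\<rho> v \<in> cl {v}" if "v \<in> V" for v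
    unfolding \<rho>_def by (rule someI[of _ v]) (use subset_cl[of "{v}"] that in auto)
  have \<rho>F: "\<rho> v \<in> F" if "v \<in> F" for v
    using \<rho>_cl[of v] cl_least[of "{a, c, b}" "{v}"] that FV abc unfolding F_def by auto
  have RF: "R \<subseteq> F" using \<rho>F by (auto simp: R_def)
  have RV: "R \<subseteq> V" using RF FV by blast
  have \<rho>_id: "\<rho> u = \<rho> v" if "u \<in> cl {v}" "v \<in> V" for u v
    unfolding \<rho>_def using cl_sing_eq[OF that(2,1)] by simp
  have R_id: "\<rho> v = v" if "v \<in> R" for v
    using that \<rho>_id \<rho>_cl FV by (auto simp: R_def)
  have R_eq: "u = v" if "u \<in> cl {v}" "u \<in> R" "v \<in> R" for u v
    using that \<rho>_id[of u v] R_id RV by auto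
  have orth_\<rho>: "orth w (\<rho> v)" if "orth w v" "w \<in> V" "v \<in> V" for v w
    using orth_cl[of "{v}" w "\<rho> v"] \<rho>_cl that by auto
  interpret R: friendship_graph R orth
  proof
    show "finite R" using fin FV finite_subset unfolding R_def by blast
    show "R \<noteq> {}" using abcF by (auto simp: R_def)
    show "orth v u" if "u \<in> R" "v \<in> R" "orth u v" for u v using that sym RV by blast
    show "\<not> orth u u" if "u \<in> R" for u using that irrefl RV by blast
    show "\<exists>!w. w \<in> R \<and> orth u w \<and> orth v w" if uv: "u \<in> R" "v \<in> R" "u \<noteq> v" for u v
    proof (rule ex_ex1I)
      obtain w where w: "w \<in> F" "orth w u" "orth w v"
        using plane_common_orth[OF abc(1,3,2) c b, of u v] uv RV unfolding F_def by blast
      then have "orth u w" "orth v w" using sym uv RV FV by blast+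
      then have "\<rho> w \<in> R" "orth u (\<rho> w)" "orth v (\<rho> w)"
        using orth_\<rho> uv RV FV w by (auto simp: R_def)
      then show "\<exists>w. w \<in> R \<and> orth u w \<and> orth v w" by blast
    next
      fix w w' assume w: "w \<in> R \<and> orth u w \<and> orth v w" "w' \<in> R \<and> orth u w' \<and> orth v w'"
      then have "orth w u" "orth w v" "orth w' u" "orth w' v" using sym uv RV by blast+
      moreover have "v \<notin> cl {u}" using R_eq uv by blast
      ultimately have "w' \<in> cl {w}"
        using plane_common_orth_unique[of a c b u v w w'] abc uv w RF unfolding F_def by blast
      then show "w = w'" using R_eq w by blast
    qed
  qed
  obtain u where u: "u \<in> R" and univ: "\<And>v. v \<in> R \<Longrightarrow> v \<noteq> u \<Longrightarrow> orth u v"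
    using R.ex_universal by blast
  have uV: "u \<in> V" using u RV by blast
  \<comment> \<open>Universality is carried over from the representatives to all points of the plane
    not parallel to \<open>u\<close>.\<close>
  have univ: "orth u v" if v: "v \<in> F" "v \<notin> cl {u}" for v
  proof -
    have "v \<in> V" using v FV by blast
    have "v \<in> cl {\<rho> v}" using in_cl_sing_sym[OF \<open>v \<in> V\<close> \<rho>_cl] \<open>v \<in> V\<close> by blast
    then have "\<rho> v \<noteq> u" using v by auto
    then have "orth u (\<rho> v)" using univ v by (auto simp: R_def)
    then show ?thesis using orth_cl[of "{\<rho> v}" u v] \<open>v \<in> cl {\<rho> v}\<close> uV cl_subset \<rho>_cl[OF \<open>v \<in> V\<close>] by blast
  qed
  have par: "orth v w" if v: "v \<in> V" "v \<in> cl {u}" and w: "w \<in> F" "w \<notin> cl {v}" for v w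
  proof -
    have "cl {v} = cl {u}" using cl_sing_eq uV v by blast
    then have "orth w u" using univ w uV FV orth_commute by auto
    then show ?thesis using orth_cl[of "{u}" w v] v w uV FV orth_commute by auto
  qed
  have ab: "b \<notin> cl {a}" "b \<notin> cl {c}" using b cl_mono[of "{a}" "{a, c}"] cl_mono[of "{c}" "{a, c}"] by auto
  have "a \<notin> cl {b}" "c \<notin> cl {b}" using ab in_cl_sing_sym abc by blast+
  \<comment> \<open>A vertex of the path parallel to \<open>u\<close> would be orthogonal to its
    neighbor on the path. Hence \<open>u\<close> is orthogonal to all three generators of the plane
    and cannot lie in it.\<close>
  then have "a \<notin> cl {u}" "b \<notin> cl {u}" "c \<notin> cl {u}"
    using par[of a b] par[of b a] par[of c b] ab path abc abcF sym by blast+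
  then have "orth u a" "orth u b" "orth u c" using univ abcF by auto
  then have "u \<notin> F" unfolding F_def using uV abc by (intro orth_not_in_cl) auto
  then show False using u RF by blast
qed

text \<open>If \<open>t\<close> were off the line \<open>L\<close>, take \<open>r\<close> on
  \<open>L\<close> orthogonal to \<open>t\<close>, and \<open>s'\<close> on \<open>L\<close> neither
  parallel nor orthogonal to \<open>s\<close>. Both \<open>s\<close> and \<open>s'\<close> turn out
  to be adjacent to \<open>t\<close>, not parallel to \<open>r\<close>, and therefore orthogonal to
  \<open>r\<close>. As they span \<open>L\<close>, the point \<open>r\<close> would be orthogonal to
  itself.\<close>

lemma line_adj_closed:
  assumes ab: "a \<in> V" "b \<in> V" "b \<notin> cl {a}" "\<not> orth a b"
    and s: "s \<in> cl {a, b}" and t: "t \<in> V" "\<not> orth s t"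
  shows "t \<in> cl {a, b}"
proof (rule ccontr)
  define L where "L = cl {a, b}"
  assume "t \<notin> cl {a, b}"
  then have tL: "t \<notin> L" by (simp add: L_def)
  have LV: "L \<subseteq> V" using cl_subset by (simp add: L_def)
  have sL: "s \<in> L" using s by (simp add: L_def)
  have sV: "s \<in> V" using sL LV by blast
  have abL: "a \<in> L" "b \<in> L" using subset_cl[of "{a, b}"] ab by (auto simp: L_def)
  have line: "cl {u, v} = L" if "u \<in> L" "v \<in> L" "v \<notin> cl {u}" for u v
    using line_eq[of a b u v] ab that by (simp add: L_def)
  have par: "orth w v" if "v \<in> cl {u}" "orth w u" "w \<in> V" "u \<in> V" for u v w
    using orth_cl[of "{u}" w v] that by simp
  have span: "orth w x" if "u \<in> L" "v \<in> L" "v \<notin> cl {u}" "w \<in> V" "orth w u" "orth w v" "x \<in> L"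
    for u v w x
    using orth_cl[of "{u, v}" w x] line[of u v] that LV by auto
  have "\<exists>s'\<in>L. s' \<notin> cl {s} \<and> \<not> orth s s'"
  proof -
    consider "s \<in> cl {a}" | "s \<in> cl {b}" | "a \<notin> cl {s}" "b \<notin> cl {s}"
      using in_cl_sing_sym sV by blast
    then show ?thesis
    proof cases
      case 1
      then have "cl {s} = cl {a}" "a \<in> cl {s}" using cl_sing_eq in_cl_sing_sym ab by blast+
      then have "b \<notin> cl {s}" "\<not> orth s b" using ab par[of a s b] sym sV by blast+
      then show ?thesis using abL by blast
    next
      case 2
      then have "cl {s} = cl {b}" "b \<in> cl {s}" using cl_sing_eq in_cl_sing_sym ab by blast+
      then have "a \<notin> cl {s}" "\<not> orth s a" using ab par[of b s a] sym sV in_cl_sing_sym by blast+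
      then show ?thesis using abL by blast
    next
      case 3
      have "\<not> orth s a \<or> \<not> orth s b"
        using orth_not_in_cl[of "{a, b}" s] ab sV s by auto
      then show ?thesis using 3 abL by blast
    qed
  qed
  then obtain s' where s': "s' \<in> L" "s' \<notin> cl {s}" "\<not> orth s s'" by blast
  obtain r where r: "r \<in> L" "orth r t" using line_meets_perp[OF ab(1-3) t(1)] L_def by blast
  have V: "s' \<in> V" "r \<in> V" using s' r LV by auto
  have tr: "orth t r" and ts: "\<not> orth t s" using r t sym V sV by blast+
  \<comment> \<open>Otherwise \<open>t\<close>, \<open>u\<close>, \<open>r\<close> is an induced
    path, hence collinear; its line is the line through \<open>u\<close> and \<open>r\<close>, which
    is \<open>L\<close>, and so \<open>t\<close> would lie on \<open>L\<close>.\<close>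
  have path: "orth u r" if u: "u \<in> L" "\<not> orth t u" "u \<notin> cl {r}" for u
  proof (rule ccontr)
    assume "\<not> orth u r"
    then have "u \<in> cl {t, r}" using induced_path_collinear[of t u r] t V u tr LV by blast
    then have "cl {u, r} = cl {t, r}" using cl_insert_eq[of "{r}" t u] t V u by simp
    moreover have "r \<notin> cl {u}" using in_cl_sing_sym u LV by blast
    moreover have "t \<in> cl {t, r}" using subset_cl[of "{t, r}"] t V by blast
    ultimately show False using line[of u r] u r tL by blast
  qed
  have "s \<notin> cl {r}" using par tr ts t V by blast
  then have sr: "orth s r" using path sL ts by blast
  then have "s' \<notin> cl {r}" using par s' sV V by blast
  moreover have "\<not> orth t s'" using span[of r s' t s] r s' calculation t tr ts sL by blast
  ultimately have "orth s' r" using path s' by blast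
  then have "orth r r" using span[of s s' r r] sL s' V sr r sym sV by blast
  then show False using irrefl V by blast
qed

end

section \<open>Uniform graphs\<close>

abbreviation nbhd_union :: "'a pair_pre_digraph \<Rightarrow> 'a set \<Rightarrow> 'a set" where
  "nbhd_union G S \<equiv> (\<Union>s\<in>S. closed_nbhd G s)"

text \<open>Legality relative to a set \<open>W\<close> already covered, so that sequences can be
  concatenated. The first vertex is tested too, which for \<open>W = {}\<close> always succeeds, and
  distinctness is a consequence.\<close>

fun cns_over :: "'a pair_pre_digraph \<Rightarrow> 'a set \<Rightarrow> 'a list \<Rightarrow> bool" where
  "cns_over G W [] \<longleftrightarrow> True"
| "cns_over G W (v # vs) \<longleftrightarrow>
     v \<in> pverts G \<and> \<not> closed_nbhd G v \<subseteq> W \<and> cns_over G (W \<union> closed_nbhd G v) vs"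

lemma cns_over_append:
  "cns_over G W (us @ vs) \<longleftrightarrow> cns_over G W us \<and> cns_over G (W \<union> nbhd_union G (set us)) vs"
  by (induction us arbitrary: W) (auto simp: Un_assoc)

lemma cns_over_subset: "cns_over G W vs \<Longrightarrow> set vs \<subseteq> pverts G"
  by (induction vs arbitrary: W) auto

lemma cns_over_nth:
  assumes "cns_over G W vs" "i < length vs"
  shows "\<not> closed_nbhd G (vs ! i) \<subseteq> W \<union> (\<Union>j<i. closed_nbhd G (vs ! j))"
  using assms
proof (induction vs arbitrary: W i)
  case (Cons v vs)
  show ?case
  proof (cases i)
    case (Suc i')
    have "(\<Union>j<Suc i'. closed_nbhd G ((v # vs) ! j))
        = closed_nbhd G v \<union> (\<Union>j<i'. closed_nbhd G (vs ! j))"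
      unfolding lessThan_Suc_eq_insert_0 by simp
    then show ?thesis using Cons.IH[of "W \<union> closed_nbhd G v" i'] Cons.prems Suc by (simp add: Un_assoc)
  qed (use Cons.prems in simp)
qed simp

lemma cns_over_imp_cns:
  assumes "cns_over G {} vs"
  shows "cns G vs"
proof -
  have new: "\<not> closed_nbhd G (vs ! i) \<subseteq> (\<Union>j<i. closed_nbhd G (vs ! j))" if "i < length vs" for i
    using cns_over_nth[OF assms that] by simp
  have "vs ! i \<noteq> vs ! j" if "i < j" "j < length vs" for i j
    using new[of j] that by fastforce
  then have "distinct vs" unfolding distinct_conv_nth by (metis nat_neq_iff)
  then show ?thesis using new cns_over_subset[OF assms] by (auto simp: cns_def)
qed

text \<open>Greedy choice: a vertex of \<open>T\<close> is taken only if its closed neighborhood is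
  not covered yet.\<close>

lemma ex_cns_over:
  assumes "finite T" "T \<subseteq> pverts G"
  shows "\<exists>vs. set vs \<subseteq> T \<and> cns_over G W vs \<and> nbhd_union G T \<subseteq> W \<union> nbhd_union G (set vs)"
  using assms
proof (induction T arbitrary: W)
  case empty
  show ?case by (intro exI[of _ "[]"]) simp
next
  case (insert t T)
  show ?case
  proof (cases "closed_nbhd G t \<subseteq> W")
    case True
    obtain vs where vs: "set vs \<subseteq> T" "cns_over G W vs" "nbhd_union G T \<subseteq> W \<union> nbhd_union G (set vs)"
      using insert.IH[of W] insert.prems by auto
    then show ?thesis using True by (intro exI[of _ vs]) auto
  next
    case False
    obtain vs where vs: "set vs \<subseteq> T" "cns_over G (W \<union> closed_nbhd G t) vs"
        "nbhd_union G T \<subseteq> W \<union> closed_nbhd G t \<union> nbhd_union G (set vs)"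
      using insert.IH[of "W \<union> closed_nbhd G t"] insert.prems by auto
    then show ?thesis using False insert.prems by (intro exI[of _ "t # vs"]) auto
  qed
qed

definition component :: "'a pair_pre_digraph \<Rightarrow> 'a \<Rightarrow> 'a set" where
  "component G v = (parcs G)\<^sup>* `` {v}"

definition component_graph :: "'a pair_pre_digraph \<Rightarrow> 'a \<Rightarrow> 'a pair_pre_digraph" where
  "component_graph G v =
     \<lparr>pverts = component G v, parcs = parcs G \<inter> component G v \<times> component G v\<rparr>"

text \<open>The closed neighborhood makes the relation false on the diagonal, as required of
  \<open>orth\<close>.\<close>

definition nonadj :: "'a pair_pre_digraph \<Rightarrow> 'a \<Rightarrow> 'a \<Rightarrow> bool" where
  "nonadj G x y \<longleftrightarrow> y \<notin> closed_nbhd G x"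

context pair_graph
begin

lemma closed_nbhd_commute: "u \<in> closed_nbhd G v \<longleftrightarrow> v \<in> closed_nbhd G u"
  using arcs_symmetric in_arcsD1 in_arcsD2 unfolding closed_nbhd_def nbhd_def by blast

lemma closed_nbhd_subset: "v \<in> pverts G \<Longrightarrow> closed_nbhd G v \<subseteq> pverts G"
  by (auto simp: closed_nbhd_def nbhd_def)

lemma self_in_closed_nbhd: "v \<in> closed_nbhd G v"
  by (simp add: closed_nbhd_def)

sublocale orthogeometry "pverts G" "nonadj G"
  by unfold_locales (auto simp: nonadj_def closed_nbhd_commute self_in_closed_nbhd pair_finite_verts)

text \<open>Contraposition: each vertex orthogonal to \<open>S\<close> is orthogonal to
  \<open>v\<close> exactly if each vertex of N[v] lies in some N[s].\<close>

lemma in_cl_iff: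
  assumes "S \<subseteq> pverts G" "v \<in> pverts G"
  shows "v \<in> cl S \<longleftrightarrow> closed_nbhd G v \<subseteq> nbhd_union G S"
proof -
  have "v \<in> cl S \<longleftrightarrow> (\<forall>w\<in>pverts G. w \<in> closed_nbhd G v \<longrightarrow> w \<in> nbhd_union G S)"
    using assms unfolding cl_def perp_def nonadj_def by (auto simp: closed_nbhd_commute)
  then show ?thesis using closed_nbhd_subset[OF assms(2)] by blast
qed

text \<open>Two legal sequences with the same union of neighbourhoods can be completed in the same way.\<close>

lemma uniform_length_eq:
  assumes "uniform k G"
    and us: "cns_over G {} us" and vs: "cns_over G {} vs"
    and eq: "nbhd_union G (set us) = nbhd_union G (set vs)"
  shows "length us = length vs"
proof -
  obtain ws where ws: "cns_over G (nbhd_union G (set us)) ws"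
      "nbhd_union G (pverts G) \<subseteq> nbhd_union G (set us) \<union> nbhd_union G (set ws)"
    using ex_cns_over[OF pair_finite_verts, of G] by blast
  have "length (xs @ ws) = k"
    if xs: "cns_over G {} xs" "nbhd_union G (set us) = nbhd_union G (set xs)" for xs
  proof -
    have leg: "cns_over G {} (xs @ ws)" using ws xs by (simp add: cns_over_append)
    have "\<exists>u\<in>set (xs @ ws). (v, u) \<in> parcs G" if v: "v \<in> pverts G - set (xs @ ws)" for v
    proof -
      have "v \<in> nbhd_union G (pverts G)" using v self_in_closed_nbhd by blast
      then have "v \<in> nbhd_union G (set (xs @ ws))" using ws(2) xs(2) by auto
      then obtain u where u: "u \<in> set (xs @ ws)" "v \<in> closed_nbhd G u" by blast
      then have "u \<in> closed_nbhd G v" "u \<noteq> v" using v closed_nbhd_commute by auto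
      then show ?thesis using u by (auto simp: closed_nbhd_def nbhd_def)
    qed
    then have "dominating_set G (set (xs @ ws))"
      using cns_over_subset[OF leg] unfolding dominating_set_def by blast
    then have "dominating_cns G (xs @ ws)"
      using cns_over_imp_cns[OF leg] by (simp add: dominating_cns_def)
    then show ?thesis using assms(1) unfolding uniform_def by blast
  qed
  from this[OF us refl] this[OF vs eq] show ?thesis by simp
qed

text \<open>Let \<open>ss\<close> be a legal sequence covering the same vertices as
  \<open>S\<close>. If exchange failed, \<open>ss @ [u]\<close> and \<open>ss @ [v, u]\<close> would
  both be legal and cover the same set, yet differ in length.\<close>

lemma uniform_exchange:
  assumes "uniform k G"
  shows "exchange_orthogeometry (pverts G) (nonadj G)"
proof
  fix S u v
  assume S: "S \<subseteq> pverts G" and u: "u \<in> pverts G" and v: "v \<in> cl (insert u S)" "v \<notin> cl S"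
  have vV: "v \<in> pverts G" using v cl_subset by blast
  show "u \<in> cl (insert v S)"
  proof (rule ccontr)
    assume no: "u \<notin> cl (insert v S)"
    obtain ss where ss: "set ss \<subseteq> S" "cns_over G {} ss" "nbhd_union G S \<subseteq> nbhd_union G (set ss)"
      using ex_cns_over[of S G "{}"] S finite_subset[OF S pair_finite_verts] by auto
    then have eq: "nbhd_union G (set ss) = nbhd_union G S" by blast
    have uS: "u \<notin> cl S" using no cl_mono[of S "insert v S"] by blast
    have "\<not> closed_nbhd G u \<subseteq> nbhd_union G S" "\<not> closed_nbhd G v \<subseteq> nbhd_union G S"
      "\<not> closed_nbhd G u \<subseteq> nbhd_union G (insert v S)" "closed_nbhd G v \<subseteq> nbhd_union G (insert u S)"
      using in_cl_iff uS v no S u vV by (metis insert_subset)+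
    then have "cns_over G {} (ss @ [u])" "cns_over G {} (ss @ [v, u])"
      "nbhd_union G (set (ss @ [u])) = nbhd_union G (set (ss @ [v, u]))"
      using ss u vV eq by (auto simp: cns_over_append Un_commute)
    then have "length (ss @ [u]) = length (ss @ [v, u])" using uniform_length_eq[OF assms] by blast
    then show False by simp
  qed
qed

section \<open>Connected components of a uniform graph\<close>

lemma component_subset: "v \<in> pverts G \<Longrightarrow> component G v \<subseteq> pverts G"
proof
  fix w assume v: "v \<in> pverts G" and "w \<in> component G v"
  then have "(v, w) \<in> (parcs G)\<^sup>*" by (simp add: component_def)
  then show "w \<in> pverts G" using v by induction (auto dest: in_arcsD2)
qed

lemma sym_parcs: "sym ((parcs G)\<^sup>*)"
  using arcs_symmetric by (intro sym_rtrancl symI) blast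

lemma component_eq:
  assumes "w \<in> component G v" shows "component G w = component G v"
proof -
  have "(v, w) \<in> (parcs G)\<^sup>*" "(w, v) \<in> (parcs G)\<^sup>*"
    using assms sym_parcs by (auto simp: component_def dest: symD)
  then show ?thesis by (auto simp: component_def intro: rtrancl_trans)
qed

lemma closed_nbhd_component:
  assumes "w \<in> component G v"
  shows "closed_nbhd G w \<subseteq> component G v"
  using assms by (auto simp: component_def closed_nbhd_def nbhd_def intro: rtrancl_into_rtrancl)

lemma closed_nbhd_component_graph:
  assumes "w \<in> component G v" "v \<in> pverts G"
  shows "closed_nbhd (component_graph G v) w = closed_nbhd G w"
proof -
  have "u \<in> component G v" "u \<in> pverts G" if "(w, u) \<in> parcs G" for u
    using assms that by (auto simp: component_def intro: rtrancl_into_rtrancl in_arcsD2)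
  then show ?thesis using assms(1) by (auto simp: closed_nbhd_def nbhd_def component_graph_def)
qed

lemma pair_graph_component_graph:
  assumes "v \<in> pverts G"
  shows "pair_graph (component_graph G v)"
proof
  show "finite (pverts (component_graph G v))"
    using finite_subset[OF component_subset[OF assms] pair_finite_verts]
    by (simp add: component_graph_def)
  show "finite (parcs (component_graph G v))"
    using pair_finite_arcs by (simp add: component_graph_def)
  show "symmetric (with_proj (component_graph G v))"
    unfolding symmetric_def using arcs_symmetric by (auto simp: component_graph_def intro!: symI)
qed (auto simp: component_graph_def dest: pair_no_loops)

lemma disjoint_union_of_components:
  assumes "pverts G \<noteq> {}"
  shows "disjoint_union_of G (component_graph G ` pverts G)"
proof -
  have self: "v \<in> component G v" for v by (simp add: component_def)
  have "pairwise (\<lambda>H K. disjnt (pverts H) (pverts K)) (component_graph G ` pverts G)"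
  proof (rule pairwiseI)
    fix H K assume "H \<in> component_graph G ` pverts G" "K \<in> component_graph G ` pverts G" "H \<noteq> K"
    then obtain v w where vw: "H = component_graph G v" "K = component_graph G w" "component_graph G v \<noteq> component_graph G w"
      by blast
    then have "component G v \<noteq> component G w" by (auto simp: component_graph_def)
    then have "component G v \<inter> component G w = {}" using component_eq by blast
    then show "disjnt (pverts H) (pverts K)" using vw by (simp add: component_graph_def disjnt_def)
  qed
  moreover have "pverts G = (\<Union>H\<in>component_graph G ` pverts G. pverts H)"
    using component_subset self by (auto simp: component_graph_def)
  moreover have "parcs G = (\<Union>H\<in>component_graph G ` pverts G. parcs H)"
  proof
    show "parcs G \<subseteq> (\<Union>H\<in>component_graph G ` pverts G. parcs H)"
    proof
      fix e assume e: "e \<in> parcs G"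
      obtain a b where ab: "e = (a, b)" by (cases e)
      have "a \<in> pverts G" "b \<in> component G a" using e ab in_arcsD1 by (auto simp: component_def)
      then have "e \<in> parcs (component_graph G a)" using e ab self by (simp add: component_graph_def)
      then show "e \<in> (\<Union>H\<in>component_graph G ` pverts G. parcs H)" using \<open>a \<in> pverts G\<close> by blast
    qed
  qed (auto simp: component_graph_def)
  ultimately show ?thesis
    using assms pair_finite_verts pair_graph_component_graph by (auto simp: disjoint_union_of_def)
qed

text \<open>By \<open>line_adj_closed\<close>, no walk starting at \<open>a\<close> leaves the
  line.\<close>

lemma component_subset_line:
  assumes "uniform k G" and ab: "a \<in> pverts G" "b \<in> pverts G" "b \<notin> cl {a}" "\<not> nonadj G a b"
  shows "component G a \<subseteq> cl {a, b}"
proof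
  interpret exchange_orthogeometry "pverts G" "nonadj G" using uniform_exchange[OF assms(1)] .
  fix w assume "w \<in> component G a"
  then have "(a, w) \<in> (parcs G)\<^sup>*" by (simp add: component_def)
  then show "w \<in> cl {a, b}"
  proof induction
    case base
    show ?case using subset_cl[of "{a, b}"] ab by auto
  next
    case (step s t)
    have "t \<in> pverts G" "\<not> nonadj G s t"
      using step(2) in_arcsD2 by (auto simp: nonadj_def closed_nbhd_def nbhd_def)
    then show ?case using line_adj_closed ab step.IH by blast
  qed
qed

text \<open>Some neighbor \<open>b\<close> of \<open>x\<close> is not parallel to \<open>x\<close>,
  so the component lies on the line through \<open>x\<close> and \<open>b\<close>. This is also the
  line through \<open>x\<close> and \<open>y\<close>, and membership in it means being covered by
  N[x] and N[y].\<close>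

lemma component_nbhds_cover:
  assumes unif: "uniform k G" and v: "v \<in> pverts G"
    and xy: "x \<in> component G v" "y \<in> component G v" "\<not> closed_nbhd G y \<subseteq> closed_nbhd G x"
  shows "component G v \<subseteq> closed_nbhd G x \<union> closed_nbhd G y"
proof
  interpret exchange_orthogeometry "pverts G" "nonadj G" using uniform_exchange[OF unif] .
  fix z assume z: "z \<in> component G v"
  have V: "x \<in> pverts G" "y \<in> pverts G" "z \<in> pverts G" using component_subset v xy z by auto
  have yx: "y \<notin> cl {x}" using in_cl_iff[of "{x}" y] V xy by simp
  have comp: "component G x = component G v" using component_eq xy by blast
  \<comment> \<open>If all neighbors of \<open>x\<close> were parallel to \<open>x\<close>, a walk
    from \<open>x\<close> could never leave the class of \<open>x\<close>, but \<open>y\<close> is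
    outside it.\<close>
  have "\<exists>b\<in>pverts G. b \<notin> cl {x} \<and> \<not> nonadj G x b"
  proof (rule ccontr)
    assume *: "\<not> ?thesis"
    have "(x, y) \<in> (parcs G)\<^sup>*" using xy(2) comp by (auto simp: component_def)
    then have "y \<in> cl {x}"
    proof induction
      case base
      show ?case using subset_cl[of "{x}"] V by simp
    next
      case (step s t)
      have st: "s \<in> pverts G" "t \<in> pverts G" "t \<in> closed_nbhd G s"
        using step(2) in_arcsD1 in_arcsD2 by (auto simp: closed_nbhd_def nbhd_def)
      then have "t \<in> closed_nbhd G x" using in_cl_iff[of "{x}" s] V step.IH by auto
      then show ?case using * st unfolding nonadj_def by blast
    qed
    then show False using yx by blast
  qed
  then obtain b where b: "b \<in> pverts G" "b \<notin> cl {x}" "\<not> nonadj G x b" by blast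
  have sub: "component G v \<subseteq> cl {x, b}" using component_subset_line[OF unif V(1) b] comp by simp
  then have "cl {x, y} = cl {x, b}" using line_eq[of x b x y] V b xy yx by blast
  then have "z \<in> cl {x, y}" using sub z by blast
  then have "closed_nbhd G z \<subseteq> closed_nbhd G x \<union> closed_nbhd G y"
    using in_cl_iff[of "{x, y}" z] V by simp
  then show "z \<in> closed_nbhd G x \<union> closed_nbhd G y" using self_in_closed_nbhd by blast
qed

text \<open>Closed neighborhoods are the same in the component and in \<open>G\<close>. The
  component is a single point or lies on a line, according to whether all its closed neighborhoods
  agree. In the first case one vertex covers everything; in the second, one is too few, and two
  legal ones leave nothing for a third.\<close>

lemma component_graph_uniform:
  assumes unif: "uniform k G" and v: "v \<in> pverts G"
  shows "uniform 1 (component_graph G v) \<or> uniform 2 (component_graph G v)"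
proof -
  let ?H = "component_graph G v" and ?C = "component G v"
  have self: "v \<in> ?C" by (simp add: component_def)
  have cns: "set vs \<subseteq> ?C" "\<And>i. \<lbrakk>1 \<le> i; i < length vs\<rbrakk> \<Longrightarrow>
      \<not> closed_nbhd G (vs ! i) \<subseteq> (\<Union>j<i. closed_nbhd G (vs ! j))"
    and dom: "?C \<subseteq> nbhd_union G (set vs)"
    if vs: "dominating_cns ?H vs" for vs
  proof -
    show sub: "set vs \<subseteq> ?C"
      using vs by (simp add: dominating_cns_def cns_def component_graph_def)
    show "\<not> closed_nbhd G (vs ! i) \<subseteq> (\<Union>j<i. closed_nbhd G (vs ! j))" if i: "1 \<le> i" "i < length vs" for i
    proof -
      have "vs ! j \<in> ?C" if "j \<le> i" for j using sub that i by (meson le_less_trans nth_mem subsetD)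
      then have "closed_nbhd ?H (vs ! j) = closed_nbhd G (vs ! j)" if "j \<le> i" for j
        using closed_nbhd_component_graph v that by blast
      moreover have "\<not> closed_nbhd ?H (vs ! i) \<subseteq> (\<Union>j<i. closed_nbhd ?H (vs ! j))"
        using vs i by (simp add: dominating_cns_def cns_def)
      ultimately show ?thesis by simp
    qed
    show "?C \<subseteq> nbhd_union G (set vs)"
    proof
      fix w assume w: "w \<in> ?C"
      show "w \<in> nbhd_union G (set vs)"
      proof (cases "w \<in> set vs")
        case True
        then show ?thesis using self_in_closed_nbhd by blast
      next
        case False
        then obtain u where "u \<in> set vs" "(w, u) \<in> parcs G"
          using vs w unfolding dominating_cns_def dominating_set_def component_graph_def by auto
        moreover have "u \<in> closed_nbhd G w"
          using calculation in_arcsD2 by (auto simp: closed_nbhd_def nbhd_def)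
        ultimately show ?thesis using closed_nbhd_commute by blast
      qed
    qed
  qed
  have nth: "vs ! i \<in> ?C" if "dominating_cns ?H vs" "i < length vs" for vs i
    using cns(1)[OF that(1)] that(2) by auto
  have ne: "vs \<noteq> []" if "dominating_cns ?H vs" for vs using dom[OF that] self by auto
  show ?thesis
  proof (cases "\<forall>x\<in>?C. \<forall>y\<in>?C. closed_nbhd G y \<subseteq> closed_nbhd G x")
    case True
    have "length vs = 1" if vs: "dominating_cns ?H vs" for vs
    proof (rule ccontr)
      assume "length vs \<noteq> 1"
      then have "1 < length vs" using ne[OF vs] by (cases vs) auto
      then have "\<not> closed_nbhd G (vs ! 1) \<subseteq> closed_nbhd G (vs ! 0)" "vs ! 0 \<in> ?C" "vs ! 1 \<in> ?C"
        using cns(2)[OF vs, of 1] nth[OF vs, of 0] nth[OF vs, of 1] ne[OF vs]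
        by (simp_all add: lessThan_Suc)
      then show False using True by blast
    qed
    then show ?thesis by (simp add: uniform_def)
  next
    case False
    then obtain x y where xy: "x \<in> ?C" "y \<in> ?C" "\<not> closed_nbhd G y \<subseteq> closed_nbhd G x" by blast
    have "length vs = 2" if vs: "dominating_cns ?H vs" for vs
    proof -
      \<comment> \<open>A single dominating \<open>u\<close> would have \<open>x\<close> and
        \<open>y\<close> in \<open>cl {u}\<close>. By exchange \<open>x\<close> and \<open>y\<close>
        would then be parallel, against their choice.\<close>
      have "length vs \<noteq> 1"
      proof
        assume "length vs = 1"
        then obtain u where u: "vs = [u]" by (auto simp: length_Suc_conv)
        have uC: "u \<in> ?C" and "?C \<subseteq> closed_nbhd G u" using cns(1)[OF vs] dom[OF vs] u by auto
        interpret exchange_orthogeometry "pverts G" "nonadj G" using uniform_exchange[OF unif] .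
        have V: "u \<in> pverts G" "x \<in> pverts G" "y \<in> pverts G"
          using component_subset v xy uC by auto
        have "closed_nbhd G x \<subseteq> closed_nbhd G u" "closed_nbhd G y \<subseteq> closed_nbhd G u"
          using \<open>?C \<subseteq> closed_nbhd G u\<close> closed_nbhd_component xy by blast+
        then have "x \<in> cl {u}" "y \<in> cl {u}" using in_cl_iff[of "{u}"] V by auto
        then have "y \<in> cl {x}" using cl_sing_eq V by blast
        then show False using in_cl_iff[of "{x}" y] V xy by simp
      qed
      moreover have "\<not> 2 < length vs"
      proof
        assume len: "2 < length vs"
        then have C: "vs ! 0 \<in> ?C" "vs ! 1 \<in> ?C" "vs ! 2 \<in> ?C" using nth[OF vs] ne[OF vs] len by simp_all
        have "{..<2::nat} = {0, 1}" by auto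
        then have "\<not> closed_nbhd G (vs ! 1) \<subseteq> closed_nbhd G (vs ! 0)"
          "\<not> closed_nbhd G (vs ! 2) \<subseteq> closed_nbhd G (vs ! 0) \<union> closed_nbhd G (vs ! 1)"
          using cns(2)[OF vs, of 1] cns(2)[OF vs, of 2] len by (simp_all add: lessThan_Suc)
        then show False
          using component_nbhds_cover[OF unif v C(1,2)] closed_nbhd_component[OF C(3)] by blast
      qed
      moreover have "length vs \<noteq> 0" using ne[OF vs] by simp
      ultimately show ?thesis by linarith
    qed
    then show ?thesis by (simp add: uniform_def)
  qed
qed

end

theorem corollary2p5:
  fixes G :: "'a pair_pre_digraph" and k :: nat
  assumes "pair_graph G"
    and "k \<ge> 1"
    and "uniform k G"
  shows "\<exists>\<H>. disjoint_union_of G \<H> \<and> (\<forall>H \<in> \<H>. uniform 1 H \<or> uniform 2 H)"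
proof -
  interpret pair_graph G by fact
  \<comment> \<open>A disjoint union needs at least one summand. The graph without vertices has the
    empty sequence as a dominating one, which \<open>k \<ge> 1\<close> rules out.\<close>
  have "pverts G \<noteq> {}"
  proof
    assume "pverts G = {}"
    then have "dominating_cns G []" by (simp add: dominating_cns_def cns_def dominating_set_def)
    then show False using assms(2,3) by (auto simp: uniform_def)
  qed
  then have "disjoint_union_of G (component_graph G ` pverts G)"
    by (rule disjoint_union_of_components)
  moreover have "\<forall>H \<in> component_graph G ` pverts G. uniform 1 H \<or> uniform 2 H"
    using component_graph_uniform[OF assms(3)] by blast
  ultimately show ?thesis by blast
qed

end
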